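(* Let $G$ be a finite group which is not an EPPO-group. Then the difference graph $\mathcal{D}(G)$ is a chordal graph if and only if $G$ satisfies condition $\mathcal{A}$.
   Context: A finite group $G$ is an EPPO-group if the order of each element of $G$ is a prime power (the identity, of order $1$, being allowed). Difference graph: the power graph $\mathcal{P}(G)$ is the simple undirected graph with vertex set $G$ in which distinct $a,b$ are adjacent iff $a\in\langle b\rangle$ or $b\in\langle a\rangle$. The enhanced power graph $\mathcal{P}_E(G)$ is the simple undirected graph with vertex set $G$ in which distinct $a,b$ are adjacent iff $a,b\in\langle c\rangle$ for some $c\in G$. The difference graph $\mathcal{D}(G)$ is obtained from the graph $\mathcal{P}_E(G)-\mathcal{P}(G)$ (vertex set $G$; two vertices are adjacent iff they are adjacent in $\mathcal{P}_E(G)$ but not in $\mathcal{P}(G)$) by removing all isolated vertices. Condition $\mathcal{A}$: there are primes $p_1,\dots,p_k>2$ such that the order of every element of $G$ is $1$, or one of $2p_1,\dots,2p_k$, or of the form $p^{\alpha}$ with $p$ a prime and $\alpha\in\mathbb{N}$; and for each $1\le i\le k$, the intersection of any two distinct cyclic subgroups of $G$ of order $2p_i$ has cardinality at most $2$. A graph is chordal if it has no induced subgraph isomorphic to a cycle $C_n$ with $n\ge 4$. *)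

theory Defs
  imports
    "HOL-Algebra.Multiplicative_Group"
    "HOL-Algebra.Elementary_Groups"
    "HOL-Number_Theory.Prime_Powers"
    "Graph_Theory.Graph_Theory"
begin

text \<open>
  A simple undirected graph is represented as a symmetric, loop-free
  \<^typ>\<open>'a pair_pre_digraph\<close>: the edge between \<open>u\<close> and \<open>v\<close> is the pair of arcs
  \<open>(u, v)\<close>, \<open>(v, u)\<close>.
\<close>

definition power_graph :: "('a, 'b) monoid_scheme \<Rightarrow> 'a pair_pre_digraph" where
  "power_graph G = \<lparr> pverts = carrier G,
     parcs = {(a, b). a \<in> carrier G \<and> b \<in> carrier G \<and> a \<noteq> b \<and>
                (a \<in> generate G {b} \<or> b \<in> generate G {a})} \<rparr>"

definition enhanced_power_graph :: "('a, 'b) monoid_scheme \<Rightarrow> 'a pair_pre_digraph" where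
  "enhanced_power_graph G = \<lparr> pverts = carrier G,
     parcs = {(a, b). a \<in> carrier G \<and> b \<in> carrier G \<and> a \<noteq> b \<and>
                (\<exists>c\<in>carrier G. a \<in> generate G {c} \<and> b \<in> generate G {c})} \<rparr>"

definition edge_difference ::
  "'a pair_pre_digraph \<Rightarrow> 'a pair_pre_digraph \<Rightarrow> 'a pair_pre_digraph" where
  "edge_difference X Y = \<lparr> pverts = pverts X, parcs = parcs X - parcs Y \<rparr>"

definition remove_isolated :: "'a pair_pre_digraph \<Rightarrow> 'a pair_pre_digraph" where
  "remove_isolated X =
     \<lparr> pverts = {v \<in> pverts X. \<exists>w \<in> pverts X. (v, w) \<in> parcs X}, parcs = parcs X \<rparr>"

definition difference_graph :: "('a, 'b) monoid_scheme \<Rightarrow> 'a pair_pre_digraph" where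
  "difference_graph G =
     remove_isolated (edge_difference (enhanced_power_graph G) (power_graph G))"

text \<open>The cycle \<open>C\<^sub>n\<close>; it is a simple graph only for \<open>n \<ge> 3\<close>.\<close>

definition cycle_graph :: "nat \<Rightarrow> nat pair_pre_digraph" where
  "cycle_graph n = \<lparr> pverts = {..<n},
     parcs = {(i, j). i < n \<and> j < n \<and> (j = (i + 1) mod n \<or> i = (j + 1) mod n)} \<rparr>"

definition chordal :: "'a pair_pre_digraph \<Rightarrow> bool" where
  "chordal X \<longleftrightarrow>
     \<not> (\<exists>n \<ge> 4. \<exists>Y :: 'a pair_pre_digraph.
          induced_subgraph (with_proj Y) (with_proj X) \<and>
          digraph_iso (with_proj Y) (with_proj (cycle_graph n)))"

text \<open>
  \<^const>\<open>primepow\<close> excludes the exponent \<open>0\<close>, so the order \<open>1\<close> of the identity is listed separately.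
\<close>

definition EPPO :: "('a, 'b) monoid_scheme \<Rightarrow> bool" where
  "EPPO G \<longleftrightarrow> (\<forall>x \<in> carrier G. group.ord G x = 1 \<or> primepow (group.ord G x))"

definition cyclic_subgroup :: "'a set \<Rightarrow> ('a, 'b) monoid_scheme \<Rightarrow> bool" where
  "cyclic_subgroup H G \<longleftrightarrow> subgroup H G \<and> cyclic_group (G\<lparr>carrier := H\<rparr>)"

text \<open>The finite set \<open>P\<close> is \<open>{p\<^sub>1, \<dots>, p\<^sub>k}\<close>.\<close>

definition condition_A :: "('a, 'b) monoid_scheme \<Rightarrow> bool" where
  "condition_A G \<longleftrightarrow>
     (\<exists>P :: nat set. finite P \<and> (\<forall>p \<in> P. prime p \<and> p > 2) \<and>
        (\<forall>x \<in> carrier G.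
           group.ord G x = 1 \<or>
           (\<exists>p \<in> P. group.ord G x = 2 * p) \<or>
           (\<exists>p \<alpha> :: nat. prime p \<and> group.ord G x = p ^ \<alpha>)) \<and>
        (\<forall>p \<in> P. \<forall>H K.
           cyclic_subgroup H G \<and> card H = 2 * p \<and>
           cyclic_subgroup K G \<and> card K = 2 * p \<and> H \<noteq> K \<longrightarrow>
           card (H \<inter> K) \<le> 2))"

text \<open>
  \<^const>\<open>induced_subgraph\<close> and \<^const>\<open>digraph_iso\<close> both require well-formed graphs; the following
  two facts show that this is satisfied, so that it does not affect \<^const>\<open>chordal\<close>.
\<close>

lemma pair_graph_difference_graph:
  assumes "finite (carrier G)"
  shows "pair_graph (difference_graph G)"
proof
  let ?D = "difference_graph G"
  have sub: "parcs ?D \<subseteq> carrier G \<times> carrier G"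
    by (auto simp: difference_graph_def remove_isolated_def edge_difference_def
        enhanced_power_graph_def)
  have symm: "(b, a) \<in> parcs ?D" if "(a, b) \<in> parcs ?D" for a b
    using that by (auto simp: difference_graph_def remove_isolated_def edge_difference_def
        enhanced_power_graph_def power_graph_def)
  have src: "a \<in> pverts ?D" if "(a, b) \<in> parcs ?D" for a b
    using that by (auto simp: difference_graph_def remove_isolated_def edge_difference_def
        enhanced_power_graph_def)
  show "fst e \<in> pverts ?D" if "e \<in> parcs ?D" for e
    using that src[of "fst e" "snd e"] by simp
  show "snd e \<in> pverts ?D" if "e \<in> parcs ?D" for e
    using that src[of "snd e" "fst e"] symm[of "fst e" "snd e"] by simp
  show "finite (pverts ?D)"
    using assms by (simp add: difference_graph_def remove_isolated_def edge_difference_def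
        enhanced_power_graph_def)
  show "finite (parcs ?D)"
    using sub assms by (meson finite_SigmaI finite_subset)
  show "fst e \<noteq> snd e" if "e \<in> parcs ?D" for e
    using that by (auto simp: difference_graph_def remove_isolated_def edge_difference_def
        enhanced_power_graph_def)
  show "symmetric (with_proj ?D)"
    using symm by (auto simp: symmetric_def sym_def)
qed

lemma pair_graph_cycle_graph:
  assumes "n \<ge> 3"
  shows "pair_graph (cycle_graph n)"
proof
  let ?C = "cycle_graph n"
  show "fst e \<in> pverts ?C" "snd e \<in> pverts ?C" if "e \<in> parcs ?C" for e
    using that by (auto simp: cycle_graph_def)
  show "finite (pverts ?C)" by (simp add: cycle_graph_def)
  have "parcs ?C \<subseteq> {..<n} \<times> {..<n}" by (auto simp: cycle_graph_def)
  then show "finite (parcs ?C)" by (rule finite_subset) simp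
  show "fst e \<noteq> snd e" if "e \<in> parcs ?C" for e
    using that assms by (auto simp: cycle_graph_def mod_Suc split: if_splits)
  show "symmetric (with_proj ?C)"
    by (auto simp: symmetric_def sym_def cycle_graph_def)
qed

end

theory Submission
  imports Defs
begin

text \<open>
  Inside a cyclic group membership in a cyclic subgroup is divisibility of orders, so two elements
  are adjacent in the difference graph iff they lie in a common cyclic subgroup and neither order
  divides the other. If adjacent \<open>a\<close> and \<open>b\<close> both have order above \<open>2\<close>, then
  \<open>a, b, a\<inverse>, b\<inverse>\<close> is an induced 4-cycle. Chordality therefore forces one end of each edge to
  be an involution, which leaves only \<open>2p\<close> as orders that are not prime powers; and if two cyclic
  subgroups of order \<open>2p\<close> with involutions \<open>u \<noteq> v\<close> share an element \<open>z\<close> of order \<open>p\<close>,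
  then \<open>z, u, z\<inverse>, v\<close> is an induced 4-cycle. Conversely, under condition \<open>\<A>\<close> each edge joins an
  involution to an element of odd prime order, and the latter has no other neighbour, so the
  graph contains no cycle at all.
\<close>

section \<open>Induced cycles\<close>

text \<open>Packages four explicit vertices as the subgraph and isomorphism over which
  \<open>chordal\<close> quantifies. Consecutive vertices differ because there are no loops,
  opposite ones by assumption.\<close>

lemma (in pair_graph) induced_four_cycle_imp_not_chordal:
  assumes arcs: "(a, b) \<in> parcs G" "(b, c) \<in> parcs G" "(c, d) \<in> parcs G" "(d, a) \<in> parcs G"
    and non_arcs: "(a, c) \<notin> parcs G" "(b, d) \<notin> parcs G" and "a \<noteq> c" "b \<noteq> d"
  shows "\<not> chordal G"
proof -
  have sym: "(x, y) \<in> parcs G \<longleftrightarrow> (y, x) \<in> parcs G" for x y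
    using arcs_symmetric by blast
  have no_loop: "(x, x) \<notin> parcs G" for x
    using no_loops by fastforce
  have neq: "a \<noteq> b" "b \<noteq> c" "c \<noteq> d" "d \<noteq> a"
    using arcs no_loop by blast+
  define V where "V = {a, b, c, d}"
  define A where "A = {(a, b), (b, a), (b, c), (c, b), (c, d), (d, c), (d, a), (a, d)}"
  define Y where "Y = \<lparr>pverts = V, parcs = A\<rparr>"
  have V: "V \<subseteq> pverts G"
    using arcs in_arcsD1 by (auto simp: V_def)
  \<comment> \<open>This is inducedness: the absent diagonals and loops leave only the eight listed
    arcs inside \<open>V\<close>.\<close>
  have A: "A = {e \<in> parcs G. fst e \<in> V \<and> snd e \<in> V}"
  proof -
    have "A \<subseteq> parcs G" "A \<subseteq> V \<times> V"
      using arcs arcs[THEN sym[THEN iffD1]] by (simp_all add: A_def V_def)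
    moreover have "(x, y) \<in> A" if "(x, y) \<in> parcs G" and V: "x \<in> V" "y \<in> V" for x y
    proof -
      have "(x, y) \<notin> {(a, a), (b, b), (c, c), (d, d), (a, c), (c, a), (b, d), (d, b)}"
        using that(1) non_arcs non_arcs[THEN contrapos_nn, OF sym[THEN iffD1]] no_loop by blast
      then show ?thesis
        using V unfolding A_def V_def by (elim insertE emptyE) simp_all
    qed
    ultimately show ?thesis by auto
  qed
  have wf: "wf_digraph (with_proj Y)"
    by unfold_locales (auto simp: Y_def A)
  have sub: "subgraph (with_proj Y) (with_proj G)"
    using V A wf by (intro subgraphI) (auto simp: Y_def wf_digraph_axioms)
  have ind: "induced_subgraph (with_proj Y) (with_proj G)"
    using sub A by (intro induced_subgraphI) (auto simp: Y_def)
  define f :: "'a \<Rightarrow> nat"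
    where "f = (\<lambda>x. if x = a then 0 else if x = b then 1 else if x = c then 2 else 3)"
  have f: "f a = 0" "f b = 1" "f c = 2" "f d = 3"
    using neq \<open>a \<noteq> c\<close> \<open>b \<noteq> d\<close> by (auto simp: f_def)
  \<comment> \<open>Arcs are pairs of vertices, so the vertex map \<open>f\<close> dictates the arc
    map.\<close>
  define h where "h = \<lparr>iso_verts = f, iso_arcs = map_prod f f, iso_head = snd, iso_tail = fst\<rparr>"
  have inj: "inj_on f V"
    using f by (auto simp: V_def inj_on_def)
  have "inj_on (map_prod f f) A"
    using map_prod_inj_on[OF inj inj] by (rule inj_on_subset) (use A in auto)
  then have iso: "pre_digraph.digraph_isomorphism (with_proj Y) h"
    using inj wf by (auto simp: pre_digraph.digraph_isomorphism_def h_def Y_def)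
  have verts: "f ` V = {..<4}"
    using f by (auto simp: V_def lessThan_nat_numeral lessThan_Suc)
  have "map_prod f f ` A = parcs (cycle_graph 4)"
  proof -
    have "parcs (cycle_graph 4) = {(0, 1), (1, 0), (1, 2), (2, 1), (2, 3), (3, 2), (3, 0), (0, 3)}"
    proof -
      have "parcs (cycle_graph 4) = (\<Union>i<4. {(i, (i + 1) mod 4), ((i + 1) mod 4, i)})"
        by (auto simp: cycle_graph_def)
      also have "{..<4::nat} = {0, 1, 2, 3}"
        by auto
      also have "(\<Union>i\<in>{0, 1, 2, 3::nat}. {(i, (i + 1) mod 4), ((i + 1) mod 4, i)}) =
          {(0, 1), (1, 0), (1, 2), (2, 1), (2, 3), (3, 2), (3, 0), (0, 3)}"
        by auto
      finally show ?thesis .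
    qed
    then show ?thesis
      using f by (simp add: A_def)
  qed
  then have "with_proj (cycle_graph 4) = app_iso h (with_proj Y)"
    using verts by (simp add: app_iso_def h_def Y_def with_proj_def cycle_graph_def)
  then have "digraph_iso (with_proj Y) (with_proj (cycle_graph 4))"
    using iso by (auto simp: digraph_iso_def)
  with ind show ?thesis
    unfolding chordal_def by blast
qed

lemma cycle_graph_two_neighbours:
  assumes "n \<ge> 3" "i < n"
  shows "\<exists>j k. j \<noteq> k \<and> (i, j) \<in> parcs (cycle_graph n) \<and> (i, k) \<in> parcs (cycle_graph n)"
proof -
  \<comment> \<open>The predecessor is written \<open>i + n - 1\<close> so that truncated
    subtraction does no harm at \<open>i = 0\<close>. It differs from the successor by 2 modulo
    \<open>n\<close>, which is nonzero as \<open>n \<ge> 3\<close>.\<close>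
  have "(i + 1) mod n \<noteq> (i + n - 1) mod n"
    using assms by (auto simp: mod_if)
  moreover have "((i + n - 1) mod n + 1) mod n = i"
    using assms by (simp add: mod_simps)
  ultimately show ?thesis
    using assms by (intro exI[of _ "(i + 1) mod n"] exI[of _ "(i + n - 1) mod n"])
      (auto simp: cycle_graph_def)
qed

text \<open>On a cycle both ends of every arc have a further neighbour, and this persists in any
  graph containing the cycle.\<close>

lemma chordal_if_arcs_have_leaf:
  assumes leaf: "\<And>u v. (u, v) \<in> parcs X \<Longrightarrow>
    (\<forall>w. (u, w) \<in> parcs X \<longrightarrow> w = v) \<or> (\<forall>w. (v, w) \<in> parcs X \<longrightarrow> w = u)"
  shows "chordal X"
  unfolding chordal_def
proof (intro notI, elim exE conjE)
  fix n Y
  assume n: "4 \<le> n" and ind: "induced_subgraph (with_proj Y) (with_proj X)"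
    and "digraph_iso (with_proj Y) (with_proj (cycle_graph n))"
  then obtain h where iso: "pre_digraph.digraph_isomorphism (with_proj Y) h"
    and app: "with_proj (cycle_graph n) = app_iso h (with_proj Y)"
    by (auto simp: digraph_iso_def)
  let ?f = "iso_verts h" and ?C = "cycle_graph n"
  have subX: "parcs Y \<subseteq> parcs X"
    using ind by (auto simp: induced_subgraph_def)
  have wf: "wf_digraph (with_proj Y)"
    using iso by (simp add: pre_digraph.digraph_isomorphism_def)
  have inj: "inj_on ?f (pverts Y)"
    using iso by (simp add: pre_digraph.digraph_isomorphism_def)
  have verts: "pverts ?C = ?f ` pverts Y"
    using arg_cong[OF app, of verts] by simp
  have arcs: "parcs ?C = map_prod ?f ?f ` parcs Y"
    using wf_digraph.arcs_ends_app_iso_eq[OF wf iso]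
    by (simp add: app[symmetric] map_prod_def)
  have Y_verts: "u \<in> pverts Y" "v \<in> pverts Y" if "(u, v) \<in> parcs Y" for u v
    using wf_digraph.tail_in_verts[OF wf, of "(u, v)"] wf_digraph.head_in_verts[OF wf, of "(u, v)"]
      that by auto
  \<comment> \<open>The two neighbours of \<open>?f u\<close> on the cycle are pulled back to
    \<open>Y\<close>; injectivity identifies the tail with \<open>u\<close>, and at least one of the
    two heads differs from \<open>v\<close>.\<close>
  have two: "\<exists>w. (u, w) \<in> parcs Y \<and> w \<noteq> v" if u: "u \<in> pverts Y" for u v
  proof -
    have "?f u < n"
      using u verts by (auto simp: cycle_graph_def)
    then obtain j k where "j \<noteq> k" "(?f u, j) \<in> parcs ?C" "(?f u, k) \<in> parcs ?C"
      using cycle_graph_two_neighbours[of n "?f u"] n by auto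
    moreover have "\<exists>w. (u, w) \<in> parcs Y \<and> ?f w = j" if j: "(?f u, j) \<in> parcs ?C" for j
    proof -
      obtain u' w where w: "(u', w) \<in> parcs Y" "?f u' = ?f u" "?f w = j"
        using j arcs by auto
      then have "u' = u"
        using Y_verts inj u by (auto dest: inj_onD)
      with w show ?thesis by auto
    qed
    ultimately show ?thesis by metis
  qed
  have "(0, 1) \<in> parcs ?C"
    using n by (simp add: cycle_graph_def)
  then obtain u v where uv: "(u, v) \<in> parcs Y"
    using arcs by auto
  with two[of u v] two[of v u] Y_verts[of u v] leaf[of u v] subX show False
    by blast
qed

section \<open>Cyclic subgroups\<close>

lemma (in group) ord_dvd_if_mem_generate:
  assumes "b \<in> carrier G" "a \<in> generate G {b}"
  shows "ord a dvd ord b"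
proof -
  obtain k :: int where k: "a = b [^] k"
    using assms generate_pow by auto
  then have a: "a \<in> carrier G"
    using assms by simp
  have "a [^] ord b = (b [^] int (ord b)) [^] k"
    using assms unfolding k by (simp add: int_pow_pow mult.commute flip: int_pow_int)
  also have "\<dots> = \<one>"
    using assms by (simp add: int_pow_int)
  finally show ?thesis
    using a by (simp add: pow_eq_id)
qed

text \<open>A finite cyclic group has one subgroup for each divisor of its order, so containment of
  subgroups is divisibility of orders.\<close>

lemma (in group) mem_generate_iff_ord_dvd:
  assumes fin: "finite (carrier G)" and c: "c \<in> carrier G"
    and a: "a \<in> generate G {c}" and b: "b \<in> generate G {c}"
  shows "a \<in> generate G {b} \<longleftrightarrow> ord a dvd ord b"
proof
  have bG: "b \<in> carrier G"
    using b c generate_in_carrier[of "{c}"] by auto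
  then show "ord a dvd ord b" if "a \<in> generate G {b}"
    using that ord_dvd_if_mem_generate by blast
  assume dvd: "ord a dvd ord b"
  obtain i j :: nat where i: "a = c [^] i" and j: "b = c [^] j"
    using a b generate_pow_on_finite_carrier[OF fin c] by auto
  let ?n = "ord c"
  have n: "?n > 0"
    using ord_ge_1[OF fin c] by simp
  \<comment> \<open>The exponents satisfy \<open>i \<cdot> ord b \<equiv> 0\<close> mod \<open>n\<close>, hence \<open>gcd j n\<close> divides \<open>i\<close>.\<close>
  have "c [^] (i * ord b) = \<one>"
    using dvd c pow_eq_id[of a "ord b"] by (simp add: i nat_pow_pow)
  then have "?n dvd i * ord b"
    using c by (simp add: pow_eq_id)
  moreover have "ord b * gcd ?n j = ?n"
    using ord_pow_gen[OF c, of j] n by (auto simp: j)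
  ultimately have "ord b * gcd ?n j dvd ord b * i"
    by (simp add: mult.commute)
  then have gcd_dvd: "gcd ?n j dvd i"
    using ord_ge_1[OF fin bG] by simp
  \<comment> \<open>Bezout makes \<open>i\<close> a multiple of \<open>j\<close> modulo
    \<open>ord c\<close>, which exhibits \<open>a\<close> as a power of \<open>b\<close>.\<close>
  obtain s t where st: "s * int ?n + t * int j = gcd (int ?n) (int j)"
    using bezout_int by blast
  obtain m where m: "i = gcd ?n j * m"
    using gcd_dvd by blast
  have "int i = (s * int ?n + t * int j) * int m"
    unfolding st m by simp
  then have "int i = int ?n * (s * int m) + int j * (t * int m)"
    by (simp add: algebra_simps)
  then have "c [^] int i = (c [^] int ?n) [^] (s * int m) \<otimes> (c [^] int j) [^] (t * int m)"
    using c by (simp only: int_pow_mult int_pow_pow)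
  then have "a = b [^] (t * int m)"
    using c by (simp add: i j int_pow_int)
  then show "a \<in> generate G {b}"
    using generate_pow[OF bG] by auto
qed

text \<open>Equal orders put \<open>a\<close> into the subgroup generated by \<open>b\<close>, whose
  only element besides \<open>\<one>\<close> is \<open>b\<close>.\<close>

lemma (in group) involution_in_cyclic_unique:
  assumes fin: "finite (carrier G)" and c: "c \<in> carrier G"
    and "a \<in> generate G {c}" "b \<in> generate G {c}" and ord: "ord a = 2" "ord b = 2"
  shows "a = b"
proof -
  have b: "b \<in> carrier G"
    using assms generate_in_carrier[of "{c}"] by auto
  have "a \<in> generate G {b}"
    using assms by (simp add: mem_generate_iff_ord_dvd)
  then obtain k :: nat where k: "a = b [^] k"
    using generate_pow_on_finite_carrier[OF fin b] by auto
  have "b [^] (2::nat) = \<one>"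
    using ord b by (simp add: pow_eq_id)
  then have "b [^] k = b [^] (k mod 2)"
    using b by (metis mult_div_mod_eq nat_pow_mult nat_pow_one nat_pow_pow l_one nat_pow_closed)
  moreover have "a \<noteq> \<one>"
    using ord by auto
  ultimately show ?thesis
    using k b by (cases "even k") (auto simp: odd_iff_mod_2_eq_one)
qed

text \<open>\<open>cyclic_group\<close> views \<open>H\<close> as a group of its own; generation
  inside a subgroup agrees with generation in \<open>G\<close>.\<close>

lemma (in group) cyclic_subgroup_iff_generate:
  "cyclic_subgroup H G \<longleftrightarrow> (\<exists>x\<in>carrier G. H = generate G {x})"
proof
  assume "cyclic_subgroup H G"
  then have H: "subgroup H G" and "cyclic_group (G\<lparr>carrier := H\<rparr>)"
    by (auto simp: cyclic_subgroup_def)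
  then obtain x where x: "x \<in> H" "subgroup_generated (G\<lparr>carrier := H\<rparr>) {x} = G\<lparr>carrier := H\<rparr>"
    by (auto simp: cyclic_group_def)
  from arg_cong[OF x(2), of carrier] x(1) have "generate (G\<lparr>carrier := H\<rparr>) {x} = H"
    by (simp add: carrier_subgroup_generated)
  then have "generate G {x} = H"
    using generate_consistent[OF _ H, of "{x}"] x by simp
  then show "\<exists>x\<in>carrier G. H = generate G {x}"
    using x H subgroup.mem_carrier by fast
next
  assume "\<exists>x\<in>carrier G. H = generate G {x}"
  then obtain x where x: "x \<in> carrier G" and H: "H = generate G {x}"
    by auto
  have sub: "subgroup H G"
    unfolding H using x by (intro generate_is_subgroup) auto
  have "G\<lparr>carrier := H\<rparr> = subgroup_generated G {x}"
    using x by (simp add: subgroup_generated_def H)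
  then show "cyclic_subgroup H G"
    using sub cyclic_group_generated[of x] by (simp add: cyclic_subgroup_def)
qed

lemma (in group) ex_ord_eq_in_cyclic:
  assumes fin: "finite (carrier G)" and x: "x \<in> carrier G" and d: "d dvd ord x"
  shows "\<exists>a\<in>generate G {x}. ord a = d"
proof -
  obtain k where k: "ord x = d * k"
    using d by blast
  moreover have "ord x > 0"
    using ord_ge_1[OF fin x] by simp
  ultimately have "ord (x [^] k) = d"
    using ord_pow[OF x, of k] by simp
  then show ?thesis
    using generate_pow_on_finite_carrier[OF fin x] by auto
qed

section \<open>Arcs of the difference graph\<close>

text \<open>Inside the common cyclic group, non-adjacency in the power graph is incomparability of
  orders. This absorbs \<open>a \<noteq> b\<close>, and removing isolated vertices keeps all
  arcs.\<close>

lemma (in group) difference_graph_arc_iff: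
  assumes "finite (carrier G)"
  shows "(a, b) \<in> parcs (difference_graph G) \<longleftrightarrow>
    (\<exists>c\<in>carrier G. a \<in> generate G {c} \<and> b \<in> generate G {c}) \<and>
    \<not> ord a dvd ord b \<and> \<not> ord b dvd ord a"
    (is "?L \<longleftrightarrow> ?R")
proof -
  have in_carrier: "x \<in> carrier G" if "x \<in> generate G {c}" "c \<in> carrier G" for x c
    using that generate_in_carrier[of "{c}"] by auto
  have "?L \<longleftrightarrow> a \<noteq> b \<and> (\<exists>c\<in>carrier G. a \<in> generate G {c} \<and> b \<in> generate G {c}) \<and>
      a \<notin> generate G {b} \<and> b \<notin> generate G {a}"
    using in_carrier
    by (auto simp: difference_graph_def remove_isolated_def edge_difference_def
        enhanced_power_graph_def power_graph_def)
  also have "\<dots> \<longleftrightarrow> ?R"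
    using mem_generate_iff_ord_dvd[OF assms] by (metis dvd_refl)
  finally show ?thesis .
qed

lemma (in group) inv_neq_self_if_ord_gt_2:
  assumes "a \<in> carrier G" "ord a > 2"
  shows "inv a \<noteq> a"
proof
  assume "inv a = a"
  then have "a [^] (2::nat) = \<one>"
    using assms r_inv[of a] by (simp add: numeral_2_eq_2)
  then have "ord a dvd 2"
    using assms by (simp add: pow_eq_id)
  then show False
    using assms dvd_imp_le[of "ord a" 2] by simp
qed

text \<open>Inversion preserves orders and cyclic subgroups, so each of \<open>a\<close>,
  \<open>inv a\<close> is adjacent to each of \<open>b\<close>, \<open>inv b\<close>, whereas an
  element and its inverse have equal orders and are not adjacent.\<close>

lemma (in group) chordal_arc_involution:
  assumes fin: "finite (carrier G)" and chordal: "chordal (difference_graph G)"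
    and arc: "(a, b) \<in> parcs (difference_graph G)"
  shows "ord a = 2 \<or> ord b = 2"
proof (rule ccontr)
  assume neq2: "\<not> (ord a = 2 \<or> ord b = 2)"
  interpret D: pair_graph "difference_graph G"
    using fin by (rule pair_graph_difference_graph)
  obtain c where c: "c \<in> carrier G" and ab: "a \<in> generate G {c}" "b \<in> generate G {c}"
    and ndvd: "\<not> ord a dvd ord b" "\<not> ord b dvd ord a"
    using arc difference_graph_arc_iff[OF fin] by blast
  have carr: "a \<in> carrier G" "b \<in> carrier G"
    using c ab generate_in_carrier[of "{c}"] by auto
  have inv: "inv a \<in> generate G {c}" "inv b \<in> generate G {c}"
    using c ab generate_m_inv_closed[of "{c}"] by auto
  \<comment> \<open>Order 1 is excluded because 1 divides every order.\<close>
  have "ord a > 2" "ord b > 2"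
    using ndvd neq2 ord_ge_1[OF fin carr(1)] ord_ge_1[OF fin carr(2)]
    by (metis One_nat_def Suc_1 Suc_lessI dvd_1_left le_antisym not_less not_less_eq_eq)+
  then have "inv a \<noteq> a" "inv b \<noteq> b"
    using carr inv_neq_self_if_ord_gt_2 by auto
  then show False
    using D.induced_four_cycle_imp_not_chordal[of a b "inv a" "inv b"] chordal c ab inv ndvd carr
    by (auto simp: difference_graph_arc_iff[OF fin])
qed

section \<open>Chordality and orders of elements\<close>

text \<open>Applying \<open>div\<close> to a full prime power factor and its cofactor splits off a
  single factor 2; applying it again shows that the odd rest is prime.\<close>

lemma eq_two_times_odd_prime_if_incomparable_divisors:
  fixes n :: nat
  assumes n: "n > 1" and not_primepow: "\<not> primepow n"
    and div: "\<And>d e. d dvd n \<Longrightarrow> e dvd n \<Longrightarrow> \<not> d dvd e \<Longrightarrow> \<not> e dvd d \<Longrightarrow> d = 2 \<or> e = 2"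
  shows "\<exists>p. prime p \<and> p > 2 \<and> n = 2 * p"
proof -
  obtain q where q: "prime q" "q dvd n"
    using n by (metis less_irrefl prime_factor_nat)
  obtain m where m: "n = q ^ multiplicity q n * m" "\<not> q dvd m"
    using multiplicity_decompose'[of n q] n q by (metis not_prime_unit less_nat_zero_code)
  define k where "k = multiplicity q n"
  have nk: "n = q ^ k * m" and k: "k > 0"
    using m n q by (auto simp: k_def prime_multiplicity_gt_zero_iff)
  have "m \<noteq> 1"
    using not_primepow q k unfolding nk primepow_def by (metis mult.right_neutral)
  have "\<not> q ^ k dvd m"
    using m(2) k by (meson dvd_power dvd_trans)
  moreover have "\<not> m dvd q ^ k"
    using m(2) \<open>m \<noteq> 1\<close> q by (auto simp: divides_primepow_nat)
  ultimately have two: "q ^ k = 2 \<or> m = 2"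
    using div[of "q ^ k" m] by (simp add: nk)
  \<comment> \<open>One of the coprime factors \<open>q ^ k\<close> and \<open>m\<close> is 2;
    \<open>r\<close> is the other.\<close>
  obtain r where r: "n = 2 * r" "odd r" "r \<noteq> 1"
  proof (cases "m = 2")
    case True
    then have "odd q"
      using m(2) q by (metis dvd_refl primes_dvd_imp_eq two_is_prime_nat)
    with True show ?thesis
      using q k by (intro that[of "q ^ k"]) (auto simp: nk)
  next
    case False
    with two have "q ^ k = 2" by simp
    then have "q = 2"
      using k q by (metis dvd_power primes_dvd_imp_eq two_is_prime_nat)
    with \<open>q ^ k = 2\<close> show ?thesis
      using m(2) \<open>m \<noteq> 1\<close> by (intro that[of m]) (auto simp: nk)
  qed
  obtain p where p: "prime p" "p dvd r"
    using r prime_factor_nat by blast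
  have "odd p"
    using p r by (meson dvd_trans)
  \<comment> \<open>Neither \<open>2 * p\<close> nor \<open>r\<close> equals 2, so by
    \<open>div\<close> they are comparable; as \<open>r\<close> is odd, it must be the
    divisor.\<close>
  have "\<not> 2 * p dvd r"
    using r by (meson dvd_mult_left)
  moreover have "2 * p dvd n" "r dvd n" "2 * p \<noteq> 2" "r \<noteq> 2"
    using r p by (auto simp: not_prime_1)
  ultimately have "r dvd 2 * p"
    using div[of "2 * p" r] by blast
  moreover have "coprime r 2"
    using r by simp
  ultimately have "r dvd p"
    by (simp add: coprime_dvd_mult_right_iff)
  then have "r = p"
    using p by (simp add: dvd_antisym)
  moreover have "p > 2"
    using p \<open>odd p\<close> prime_gt_1_nat[of p] by (cases "p = 2") auto
  ultimately show ?thesis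
    using r p by auto
qed

text \<open>Every divisor of \<open>ord x\<close> is the order of a power of \<open>x\<close>, so
  incomparable divisors yield an arc, one end of which is an involution.\<close>

lemma (in group) chordal_ord_cases:
  assumes fin: "finite (carrier G)" and chordal: "chordal (difference_graph G)"
    and x: "x \<in> carrier G"
  shows "ord x = 1 \<or> primepow (ord x) \<or> (\<exists>p. prime p \<and> p > 2 \<and> ord x = 2 * p)"
proof -
  have "d = 2 \<or> e = 2"
    if de: "d dvd ord x" "e dvd ord x" and ndvd: "\<not> d dvd e" "\<not> e dvd d" for d e
  proof -
    obtain a b where "a \<in> generate G {x}" "b \<in> generate G {x}" and ord: "ord a = d" "ord b = e"
      using ex_ord_eq_in_cyclic[OF fin x] de by blast
    then have "(a, b) \<in> parcs (difference_graph G)"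
      using x ndvd by (auto simp: difference_graph_arc_iff[OF fin])
    then show ?thesis
      using chordal_arc_involution[OF fin chordal] ord by blast
  qed
  then show ?thesis
    using eq_two_times_odd_prime_if_incomparable_divisors[of "ord x"] ord_ge_1[OF fin x] by force
qed

section \<open>Intersections of cyclic subgroups of order \<open>2 * p\<close>\<close>

lemma dvd_two_times_prime_iff:
  fixes p :: nat
  assumes "prime p"
  shows "d dvd 2 * p \<longleftrightarrow> d \<in> {1, 2, p, 2 * p}"
proof
  assume "d dvd 2 * p"
  then obtain a b where d: "d = a * b" and "a dvd 2" "b dvd p"
    using division_decomp by blast
  then have "a = 1 \<or> a = 2" "b = 1 \<or> b = p"
    using assms two_is_prime_nat prime_nat_iff by metis+
  then show "d \<in> {1, 2, p, 2 * p}"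
    using d by auto
qed auto

text \<open>A larger intersection contains some \<open>z\<close> of order \<open>p\<close>. Then
  \<open>z\<close> and \<open>inv z\<close> are adjacent to the involutions \<open>u\<close> of
  \<open>?H\<close> and \<open>v\<close> of \<open>?K\<close>, and equal orders rule out both
  diagonals.\<close>

lemma (in group) chordal_cyclic_inter:
  assumes fin: "finite (carrier G)" and chordal: "chordal (difference_graph G)"
    and p: "prime p" "p > 2"
    and x: "x \<in> carrier G" "ord x = 2 * p" and y: "y \<in> carrier G" "ord y = 2 * p"
    and neq: "generate G {x} \<noteq> generate G {y}"
  shows "card (generate G {x} \<inter> generate G {y}) \<le> 2"
proof (rule ccontr)
  let ?H = "generate G {x}" and ?K = "generate G {y}"
  assume card: "\<not> card (?H \<inter> ?K) \<le> 2"
  interpret D: pair_graph "difference_graph G"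
    using fin by (rule pair_graph_difference_graph)
  have K: "subgroup ?K G"
    using y by (intro generate_is_subgroup) auto
  have HG: "?H \<subseteq> carrier G" and KG: "?K \<subseteq> carrier G"
    using x y generate_incl by auto
  have x_notin: "x \<notin> ?K"
  proof
    assume "x \<in> ?K"
    then have "?H \<subseteq> ?K"
      using K generate_subgroup_incl by blast
    moreover have "card ?H = card ?K"
      using x y generate_pow_card by metis
    ultimately show False
      using neq card_subset_eq finite_subset[OF KG fin] by blast
  qed
  obtain u where u: "u \<in> ?H" "ord u = 2"
    using ex_ord_eq_in_cyclic[OF fin x(1), of 2] x by auto
  obtain v where v: "v \<in> ?K" "ord v = 2"
    using ex_ord_eq_in_cyclic[OF fin y(1), of 2] y by auto
  \<comment> \<open>Avoiding \<open>\<one>\<close> and \<open>u\<close>, the only involution of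
    \<open>?H\<close>, keeps the order of \<open>z\<close> away from 1 and 2; order
    \<open>2 * p\<close> would put \<open>x\<close> into \<open>?K\<close>.\<close>
  have "\<not> ?H \<inter> ?K \<subseteq> {\<one>, u}"
  proof
    assume "?H \<inter> ?K \<subseteq> {\<one>, u}"
    then have "card (?H \<inter> ?K) \<le> card {\<one>, u}"
      by (intro card_mono) auto
    also have "\<dots> \<le> 2"
      by (simp add: card_insert_if)
    finally show False
      using card by simp
  qed
  then obtain z where z: "z \<in> ?H" "z \<in> ?K" "z \<noteq> \<one>" "z \<noteq> u"
    by auto
  have zG: "z \<in> carrier G"
    using z HG by blast
  have x_self: "x \<in> ?H"
    by (simp add: generate.incl)
  have sub_K: "w \<in> ?K" if "w \<in> generate G {z}" for w
    using that generate_subgroup_incl[OF _ K, of "{z}"] z by blast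
  have "ord z dvd 2 * p"
    using ord_dvd_if_mem_generate x z by metis
  moreover have "ord z \<noteq> 1"
    using z zG ord_eq_1 by blast
  moreover have "ord z \<noteq> 2"
    using z u involution_in_cyclic_unique[OF fin x(1)] by blast
  moreover have "ord z \<noteq> 2 * p"
    using mem_generate_iff_ord_dvd[OF fin x(1) x_self z(1)] x sub_K x_notin by auto
  ultimately have ord_z: "ord z = p"
    using dvd_two_times_prime_iff[OF p(1)] by auto
  have odd: "odd p"
    using p prime_odd_nat by blast
  \<comment> \<open>If \<open>u = v\<close>, then \<open>?K\<close> contains
    \<open>x [^] p = u\<close> and also the square of \<open>x\<close>, which is a power of
    \<open>z\<close>. As \<open>p\<close> is odd, these two powers produce \<open>x\<close>
    itself.\<close>
  have "u \<noteq> v"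
  proof
    assume "u = v"
    have "x [^] p \<in> ?H" "x [^] (2::nat) \<in> ?H"
      using generate_pow_on_finite_carrier[OF fin x(1)] by auto
    moreover have "ord (x [^] p) = 2" "ord (x [^] (2::nat)) = p"
      using ord_pow[OF x(1), of p] ord_pow[OF x(1), of 2] x p by auto
    ultimately have "x [^] p = u" and "x [^] (2::nat) \<in> generate G {z}"
      using involution_in_cyclic_unique[OF fin x(1)] u z ord_z
        mem_generate_iff_ord_dvd[OF fin x(1)] by auto
    then have xp: "x [^] p \<in> ?K" and x2: "x [^] (2::nat) \<in> ?K"
      using v \<open>u = v\<close> sub_K by auto
    obtain k where k: "p = 2 * k + 1"
      using odd by (rule oddE)
    have "x [^] p = (x [^] (2::nat)) [^] k \<otimes> x"
      using x by (simp add: k nat_pow_pow)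
    then have "x = inv ((x [^] (2::nat)) [^] k) \<otimes> x [^] p"
      using x by (simp add: m_assoc[symmetric])
    moreover have "(x [^] (2::nat)) [^] k \<in> ?K"
      using K x2 by (induction k) (auto intro: subgroup.one_closed subgroup.m_closed)
    ultimately show False
      using xp K x_notin by (metis subgroup.m_closed subgroup.m_inv_closed)
  qed
  have zi: "inv z \<in> ?H" "inv z \<in> ?K"
    using z generate_m_inv_closed[of "{x}"] generate_m_inv_closed[of "{y}"] x y by auto
  have ndvd: "\<not> p dvd 2" "\<not> 2 dvd p"
    using p odd dvd_imp_le[of p 2] by auto
  have "inv z \<noteq> z"
    using inv_neq_self_if_ord_gt_2[OF zG] ord_z p by simp
  then show False
    using D.induced_four_cycle_imp_not_chordal[of z u "inv z" v] chordal x(1) y(1) z zi u v ndvd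
      ord_z zG \<open>u \<noteq> v\<close>
    by (auto simp: difference_graph_arc_iff[OF fin])
qed

section \<open>The two implications between chordality and \<open>condition_A\<close>\<close>

lemma (in group) condition_A_if_chordal:
  assumes fin: "finite (carrier G)" and chordal: "chordal (difference_graph G)"
  shows "condition_A G"
  unfolding condition_A_def
\<comment> \<open>Only primes \<open>p\<close> for which \<open>2 * p\<close> occurs as an order are
  taken, which makes the set finite.\<close>
proof (intro exI[of _ "{p. prime p \<and> p > 2 \<and> (\<exists>x\<in>carrier G. ord x = 2 * p)}"] conjI
    ballI allI impI)
  let ?P = "{p. prime p \<and> p > 2 \<and> (\<exists>x\<in>carrier G. ord x = 2 * p)}"
  have "?P \<subseteq> (\<lambda>x. ord x div 2) ` carrier G"
  proof
    fix p assume "p \<in> ?P"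
    then obtain x where "x \<in> carrier G" "ord x = 2 * p"
      by blast
    then show "p \<in> (\<lambda>x. ord x div 2) ` carrier G"
      by (intro image_eqI[of _ _ x]) simp_all
  qed
  then show "finite ?P"
    using fin finite_surj by blast
  show "ord x = 1 \<or> (\<exists>p\<in>?P. ord x = 2 * p) \<or> (\<exists>p \<alpha> :: nat. prime p \<and> ord x = p ^ \<alpha>)"
    if "x \<in> carrier G" for x
    using chordal_ord_cases[OF fin chordal that] that by (auto simp: primepow_def)
  show "card (H \<inter> K) \<le> 2"
    if "p \<in> ?P" and HK: "cyclic_subgroup H G \<and> card H = 2 * p \<and>
      cyclic_subgroup K G \<and> card K = 2 * p \<and> H \<noteq> K" for p H K
  proof -
    obtain x y where "x \<in> carrier G" "H = generate G {x}" "y \<in> carrier G" "K = generate G {y}"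
      using HK cyclic_subgroup_iff_generate by auto
    then show ?thesis
      using chordal_cyclic_inter[OF fin chordal, of p x y] that generate_pow_card by auto
  qed
qed auto

text \<open>The end of odd prime order is the leaf: two cyclic subgroups of order
  \<open>2 * p\<close> through it share at least \<open>p > 2\<close> elements, hence coincide, and
  they have a single involution.\<close>

lemma (in group) chordal_if_condition_A:
  assumes fin: "finite (carrier G)" and "condition_A G"
  shows "chordal (difference_graph G)"
proof (rule chordal_if_arcs_have_leaf)
  let ?D = "difference_graph G"
  obtain P where P: "\<forall>p\<in>P. prime p \<and> p > 2"
    and ords: "\<forall>x\<in>carrier G. ord x = 1 \<or> (\<exists>p\<in>P. ord x = 2 * p) \<or>
      (\<exists>p \<alpha> :: nat. prime p \<and> ord x = p ^ \<alpha>)"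
    and inter: "\<forall>p\<in>P. \<forall>H K. cyclic_subgroup H G \<and> card H = 2 * p \<and>
      cyclic_subgroup K G \<and> card K = 2 * p \<and> H \<noteq> K \<longrightarrow> card (H \<inter> K) \<le> 2"
    using assms(2) unfolding condition_A_def by (elim exE conjE) (rule that)
  have arc: "\<exists>p\<in>P. \<exists>c\<in>carrier G. a \<in> generate G {c} \<and> b \<in> generate G {c} \<and> ord c = 2 * p \<and>
      (ord a = 2 \<and> ord b = p \<or> ord a = p \<and> ord b = 2)"
    if ab: "(a, b) \<in> parcs ?D" for a b
  proof -
    obtain c where c: "c \<in> carrier G" "a \<in> generate G {c}" "b \<in> generate G {c}"
      and ndvd: "\<not> ord a dvd ord b" "\<not> ord b dvd ord a"
      using ab difference_graph_arc_iff[OF fin] by blast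
    have dvd: "ord a dvd ord c" "ord b dvd ord c"
      using c ord_dvd_if_mem_generate by auto
    \<comment> \<open>The divisors of a prime power form a chain, so they cannot be
      incomparable.\<close>
    have "\<not> (prime p \<and> ord c = p ^ \<alpha>)" for p \<alpha> :: nat
    proof
      assume pc: "prime p \<and> ord c = p ^ \<alpha>"
      then obtain i j where "ord a = p ^ i" "ord b = p ^ j"
        using dvd by (metis divides_primepow_nat)
      then show False
        using ndvd by (metis le_imp_power_dvd nat_le_linear)
    qed
    moreover have "ord c \<noteq> 1"
      using dvd ndvd by auto
    ultimately obtain p where p: "p \<in> P" "ord c = 2 * p"
      using ords c(1) by blast
    then have "ord a \<in> {1, 2, p, 2 * p}" "ord b \<in> {1, 2, p, 2 * p}"
      using dvd dvd_two_times_prime_iff[of p] P by metis+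
    then have "ord a = 2 \<and> ord b = p \<or> ord a = p \<and> ord b = 2"
      using ndvd by auto
    then show ?thesis
      using c p by blast
  qed
  have leaf: "v = w" if uv: "(u, v) \<in> parcs ?D" and uw: "(u, w) \<in> parcs ?D" and u: "ord u \<noteq> 2"
    for u v w
  proof -
    obtain p c where p: "p \<in> P" and c: "c \<in> carrier G" "u \<in> generate G {c}" "v \<in> generate G {c}"
      and ord: "ord c = 2 * p" "ord u = p" "ord v = 2"
      using arc[OF uv] u by auto
    obtain d where d: "d \<in> carrier G" "u \<in> generate G {d}" "w \<in> generate G {d}"
      and ord': "ord d = 2 * p" "ord w = 2"
      using arc[OF uw] u ord by auto
    have uG: "u \<in> carrier G"
      using c generate_in_carrier[of "{c}"] by auto
    have "generate G {c} = generate G {d}"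
    proof (rule ccontr)
      assume "generate G {c} \<noteq> generate G {d}"
      then have "card (generate G {c} \<inter> generate G {d}) \<le> 2"
        using inter p cyclic_subgroup_iff_generate c d ord ord' generate_pow_card by metis
      moreover have "generate G {u} \<subseteq> generate G {c} \<inter> generate G {d}"
        using c d generate_subgroup_incl[OF _ generate_is_subgroup, of "{u}" "{c}"]
          generate_subgroup_incl[OF _ generate_is_subgroup, of "{u}" "{d}"] by auto
      moreover have "finite (generate G {c} \<inter> generate G {d})"
        using c(1) fin generate_incl[of "{c}"] finite_subset by auto
      ultimately have "ord u \<le> 2"
        unfolding generate_pow_card[OF uG] by (meson card_mono le_trans)
      then show False
        using ord P p by auto
    qed
    then show ?thesis
      using involution_in_cyclic_unique[OF fin c(1), of v w] c d ord ord' by simp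
  qed
  fix u v assume uv: "(u, v) \<in> parcs ?D"
  then have vu: "(v, u) \<in> parcs ?D"
    using difference_graph_arc_iff[OF fin] by blast
  \<comment> \<open>Two involutions have comparable orders, so \<open>leaf\<close> applies to at
    least one end.\<close>
  have "ord u \<noteq> 2 \<or> ord v \<noteq> 2"
    using uv difference_graph_arc_iff[OF fin] by force
  then show "(\<forall>w. (u, w) \<in> parcs ?D \<longrightarrow> w = v) \<or> (\<forall>w. (v, w) \<in> parcs ?D \<longrightarrow> w = u)"
    using leaf uv vu by metis
qed

theorem theorem3p8:
  fixes G :: "('a, 'b) monoid_scheme"
  assumes "group G" and "finite (carrier G)" and "\<not> EPPO G"
  shows "chordal (difference_graph G) \<longleftrightarrow> condition_A G"
  using group.condition_A_if_chordal[OF assms(1,2)] group.chordal_if_condition_A[OF assms(1,2)]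
  by blast

end
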